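(* Let $n \geq 1$ and let $G$ be the sibling tree $ST_n$. Then the total domination number of $G$ is $$\gamma_t(G) = \begin{cases} \frac{1}{7}(2^{n+2}+3) & \text{if } n\equiv 0 \pmod 3,\\ \frac{1}{7}(2^{n+2}-1)+1 & \text{if } n\equiv 1 \pmod 3,\\ \frac{2}{7}(2^{n+1}-1) & \text{if } n\equiv 2 \pmod 3.\end{cases}$$
   Context: The sibling tree $ST_n$ has vertex set $\{1,2,\dots,2^{n+1}-1\}$; its edges are the edges of the complete binary tree of height $n$ in which vertex $x$ has children $2x$ and $2x+1$ (root $1$ at level $0$; vertex $v$ is at level $i$ iff $2^i\le v\le 2^{i+1}-1$), together with the sibling edges $\{2x,2x+1\}$ for every $x$ with $1\le x\le 2^n-1$. A set $S\subseteq V(G)$ is a total dominating set if every vertex of $V(G)$ is adjacent to some vertex of $S$; $\gamma_t(G)$ is the minimum cardinality of a total dominating set. *)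

theory Defs
  imports Complex_Main
begin

text \<open>A finite simple graph is given by its vertex set and its set of edges,
  an edge being the two-element set of its endpoints.\<close>

definition adjacent :: "'a set set \<Rightarrow> 'a \<Rightarrow> 'a \<Rightarrow> bool" where
  "adjacent E u v \<longleftrightarrow> {u, v} \<in> E"

definition total_dominating_set :: "'a set \<Rightarrow> 'a set set \<Rightarrow> 'a set \<Rightarrow> bool" where
  "total_dominating_set V E S \<longleftrightarrow> S \<subseteq> V \<and> (\<forall>v\<in>V. \<exists>u\<in>S. adjacent E v u)"

text \<open>Meaningful for finite graphs without isolated vertices; these are exactly the finite
  graphs that have a total dominating set.\<close>

definition total_domination_number :: "'a set \<Rightarrow> 'a set set \<Rightarrow> nat" where
  "total_domination_number V E = Min (card ` {S. total_dominating_set V E S})"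

definition ST_verts :: "nat \<Rightarrow> nat set" where
  "ST_verts n = {1..2 ^ (n + 1) - 1}"

definition binary_tree_edges :: "nat \<Rightarrow> nat set set" where
  "binary_tree_edges n =
    {{x, y} | x y. x \<in> ST_verts n \<and> y \<in> ST_verts n \<and> (y = 2 * x \<or> y = 2 * x + 1)}"

definition sibling_edges :: "nat \<Rightarrow> nat set set" where
  "sibling_edges n = {{2 * x, 2 * x + 1} | x. 1 \<le> x \<and> x \<le> 2 ^ n - 1}"

definition ST_edges :: "nat \<Rightarrow> nat set set" where
  "ST_edges n = binary_tree_edges n \<union> sibling_edges n"

end

theory Submission
  imports Defs
begin

text \<open>Put \<open>a 0 = 1\<close>, \<open>a 1 = a 2 = 2\<close> and \<open>a (n + 3) = a n + 2 ^ (n + 2)\<close>.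

  Lower bound: by induction on \<open>n\<close>, any set dominating the levels \<open>0, \<dots>, n\<close> of the infinite
  sibling tree has at least \<open>a n\<close> elements on the levels \<open>0, \<dots>, n + 1\<close>.
  In the step from \<open>n\<close> to \<open>n + 3\<close>, for each of the \<open>2 ^ (n + 2)\<close> vertices \<open>p\<close> of level \<open>n + 2\<close> the
  dominator of the child \<open>2 * p\<close> lies among the seven descendants of \<open>p\<close> on the levels
  \<open>n + 2, n + 3, n + 4\<close>; these are disjoint for different \<open>p\<close> and avoid the levels up to \<open>n + 1\<close>.
  Allowing dominators one level further down than the dominated vertices makes the induction work.

  Upper bound: level \<open>n + 2\<close> dominates the levels \<open>n + 1, n + 2, n + 3\<close>, so adding it to a
  dominating set for height \<open>n\<close> yields one for height \<open>n + 3\<close>.\<close>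

text \<open>Adjacency in the infinite sibling tree, independent of the height. Since
  \<open>1 div 2 = 0\<close>, the number \<open>0\<close> counts as a neighbour of the root and has
  to be kept out of the dominating sets below.\<close>

definition sibling_tree_adj :: "nat \<Rightarrow> nat \<Rightarrow> bool" where
  "sibling_tree_adj u v \<longleftrightarrow> u div 2 = v \<or> v div 2 = u \<or> (u div 2 = v div 2 \<and> u \<noteq> v)"

lemma mem_ST_verts: "v \<in> ST_verts n \<longleftrightarrow> 1 \<le> v \<and> v < 2 ^ (n + 1)"
proof -
  have "(0::nat) < 2 ^ (n + 1)" by simp
  then show ?thesis unfolding ST_verts_def atLeastAtMost_iff by linarith
qed

lemma adjacent_ST_iff:
  "adjacent (ST_edges n) u v \<longleftrightarrow> u \<in> ST_verts n \<and> v \<in> ST_verts n \<and> sibling_tree_adj u v"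
proof
  assume "adjacent (ST_edges n) u v"
  then consider
    (tree) x y where "{u, v} = {x, y}" "x \<in> ST_verts n" "y \<in> ST_verts n" "y = 2 * x \<or> y = 2 * x + 1"
  | (sib) x where "{u, v} = {2 * x, 2 * x + 1}" "1 \<le> x" "x \<le> 2 ^ n - 1"
    unfolding adjacent_def ST_edges_def binary_tree_edges_def sibling_edges_def by auto
  then show "u \<in> ST_verts n \<and> v \<in> ST_verts n \<and> sibling_tree_adj u v"
  proof cases
    case tree
    then show ?thesis unfolding sibling_tree_adj_def doubleton_eq_iff by auto
  next
    case sib
    then have "2 * x + 1 < 2 ^ (n + 1)" by simp
    with sib show ?thesis
      unfolding sibling_tree_adj_def doubleton_eq_iff mem_ST_verts by auto
  qed
next
  assume uv: "u \<in> ST_verts n \<and> v \<in> ST_verts n \<and> sibling_tree_adj u v"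
  have tree: "{x, y} \<in> ST_edges n" if "x \<in> ST_verts n" "y \<in> ST_verts n" "y div 2 = x" for x y
  proof -
    have "y = 2 * x \<or> y = 2 * x + 1" using that(3) by auto
    with that show ?thesis unfolding ST_edges_def binary_tree_edges_def by blast
  qed
  have sib: "{u, v} \<in> ST_edges n" if "u div 2 = v div 2" "u \<noteq> v"
  proof -
    define x where "x = u div 2"
    have "(u = 2 * x \<and> v = 2 * x + 1) \<or> (v = 2 * x \<and> u = 2 * x + 1)"
      using that unfolding x_def by presburger
    then have "{u, v} = {2 * x, 2 * x + 1}" by auto
    \<comment> \<open>The root has no sibling: \<open>x = 0\<close> would force
      \<open>u = v = 1\<close>.\<close>
    moreover have "1 \<le> x" using that uv unfolding x_def mem_ST_verts by linarith
    moreover have "x < 2 ^ n"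
      using uv unfolding x_def mem_ST_verts by (simp add: less_mult_imp_div_less)
    then have "x \<le> 2 ^ n - 1" by linarith
    ultimately show ?thesis unfolding ST_edges_def sibling_edges_def by blast
  qed
  show "adjacent (ST_edges n) u v"
    using uv tree[of u v] tree[of v u] sib
    unfolding adjacent_def sibling_tree_adj_def by (auto simp: insert_commute)
qed

fun td_count :: "nat \<Rightarrow> nat" where
  "td_count 0 = 1"
| "td_count (Suc 0) = 2"
| "td_count (Suc (Suc 0)) = 2"
| "td_count (Suc (Suc (Suc n))) = td_count n + 2 ^ (n + 2)"

text \<open>In each residue class, raising \<open>n\<close> by 3 adds
  \<open>(2 ^ (n + 5) - 2 ^ (n + 2)) / 7 = 2 ^ (n + 2)\<close> to the formula.\<close>

lemma td_count_closed_form: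
  "real (td_count n) =
    (if n mod 3 = 0 then 1 / 7 * (2 ^ (n + 2) + 3)
     else if n mod 3 = 1 then 1 / 7 * (2 ^ (n + 2) - 1) + 1
     else 2 / 7 * (2 ^ (n + 1) - 1))"
proof (induction n rule: td_count.induct)
  case (4 n)
  have "Suc (Suc (Suc n)) mod 3 = n mod 3" by presburger
  with 4 show ?case by (auto simp: field_simps split: if_splits)
qed simp_all

lemma card_three_levels_ge:
  assumes dom: "\<And>p. 2 ^ k \<le> p \<Longrightarrow> p < 2 ^ (k + 1) \<Longrightarrow> \<exists>u\<in>S. sibling_tree_adj (2 * p) u"
  shows "2 ^ k \<le> card (S \<inter> {2 ^ k..<2 ^ (k + 3)})"
proof -
  \<comment> \<open>On the levels \<open>k\<close> to \<open>k + 2\<close> this is the ancestor on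
    level \<open>k\<close>. That it maps the part of \<open>S\<close> on these levels onto level
    \<open>k\<close> replaces a sum over disjoint subtrees.\<close>
  define anc :: "nat \<Rightarrow> nat" where
    "anc x = (if x < 2 ^ (k + 1) then x else if x < 2 ^ (k + 2) then x div 2 else x div 4)" for x
  have "{2 ^ k..<2 ^ (k + 1)} \<subseteq> anc ` (S \<inter> {2 ^ k..<2 ^ (k + 3)})"
  proof
    fix p :: nat assume "p \<in> {2 ^ k..<2 ^ (k + 1)}"
    then have p: "2 ^ k \<le> p" "p < 2 * 2 ^ k" by auto
    then obtain u where u: "u \<in> S" "sibling_tree_adj (2 * p) u" using dom by fastforce
    \<comment> \<open>The parent, the sibling and the children of \<open>2 * p\<close>.\<close>
    then have cases: "u = p \<or> u div 2 = p \<or> u div 2 = 2 * p"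
      unfolding sibling_tree_adj_def by auto
    have "anc u = p \<and> u \<in> {2 ^ k..<2 ^ (k + 3)}"
      using cases
    proof (elim disjE)
      assume "u div 2 = p"
      then have "2 * p \<le> u" "u \<le> 2 * p + 1" by auto
      with p \<open>u div 2 = p\<close> show ?thesis by (auto simp: anc_def power_add)
    next
      assume "u div 2 = 2 * p"
      then have "4 * p \<le> u" "u \<le> 4 * p + 3" "u div 4 = p" by auto
      with p show ?thesis by (auto simp: anc_def power_add)
    qed (use p in \<open>auto simp: anc_def power_add\<close>)
    with u(1) show "p \<in> anc ` (S \<inter> {2 ^ k..<2 ^ (k + 3)})" by blast
  qed
  from surj_card_le[OF _ this] show ?thesis by simp
qed

lemma td_count_le_card:
  assumes "\<And>v. 1 \<le> v \<Longrightarrow> v < 2 ^ (n + 1) \<Longrightarrow> \<exists>u\<in>S. sibling_tree_adj v u"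
    and "0 \<notin> S"
  shows "td_count n \<le> card (S \<inter> {..<2 ^ (n + 2)})"
  using assms
proof (induction n rule: td_count.induct)
  \<comment> \<open>Serves \<open>n = 1\<close> and \<open>n = 2\<close>: the root is dominated by 2
    or 3, which in turn needs a dominator other than itself; both lie below 8.\<close>
  have two: "2 \<le> card (S \<inter> {..<m})" if "8 \<le> m" "0 \<notin> S"
    and dom: "\<And>v. 1 \<le> v \<Longrightarrow> v < 4 \<Longrightarrow> \<exists>u\<in>S. sibling_tree_adj v u" for m
  proof -
    have nbr: "u < 8 \<and> u \<noteq> v" if "1 \<le> v" "v < 4" "sibling_tree_adj v u" "u \<in> S" for u v
      using that \<open>0 \<notin> S\<close> unfolding sibling_tree_adj_def by auto
    obtain x where x: "x \<in> S" "sibling_tree_adj 1 x" using dom[of 1] by auto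
    then have "x \<in> {2, 3}"
      using \<open>0 \<notin> S\<close> unfolding sibling_tree_adj_def by (cases "x = 0") auto
    then have "1 \<le> x" "x < 4" by auto
    then obtain y where y: "y \<in> S" "sibling_tree_adj x y" using dom by blast
    then have "y < 8" "y \<noteq> x" using nbr \<open>1 \<le> x\<close> \<open>x < 4\<close> by blast+
    then have "{x, y} \<subseteq> S \<inter> {..<m}" using x y \<open>x < 4\<close> \<open>8 \<le> m\<close> by auto
    from card_mono[OF _ this] show ?thesis using \<open>y \<noteq> x\<close> by auto
  qed
  {
    case 1
    obtain x where x: "x \<in> S" "sibling_tree_adj 1 x" using 1(1)[of 1] by auto
    then have "x \<in> {2, 3}"
      using \<open>0 \<notin> S\<close> unfolding sibling_tree_adj_def by (cases "x = 0") auto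
    then have "{x} \<subseteq> S \<inter> {..<2 ^ (0 + 2)}" using x by auto
    from card_mono[OF _ this] show ?case by simp
  next
    case 2
    show ?case using two[of 8] 2 by simp
  next
    case 3
    show ?case using two[of 16] 3 by simp
  next
    case (4 n)
    have pow: "(2::nat) ^ (n + 1) \<le> 2 ^ (Suc (Suc (Suc n)) + 1)" by (rule power_increasing) auto
    have IH: "td_count n \<le> card (S \<inter> {..<2 ^ (n + 2)})"
      using 4 pow by (meson order_less_le_trans)
    have "2 ^ (n + 2) \<le> card (S \<inter> {2 ^ (n + 2)..<2 ^ (n + 2 + 3)})"
    \<comment> \<open>Here \<open>2 * p\<close> is on level \<open>n + 3\<close>, the last dominated
      one, so its dominators may reach level \<open>n + 4\<close>.\<close>
    proof (rule card_three_levels_ge)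
      fix p :: nat assume "2 ^ (n + 2) \<le> p" "p < 2 ^ (n + 2 + 1)"
      moreover have "(0::nat) < 2 ^ (n + 2)" by simp
      ultimately have "1 \<le> 2 * p" "2 * p < 2 ^ (Suc (Suc (Suc n)) + 1)"
        by (linarith, simp)
      then show "\<exists>u\<in>S. sibling_tree_adj (2 * p) u" by (rule 4(2))
    qed
    with IH have "td_count n + 2 ^ (n + 2) \<le>
        card (S \<inter> {..<2 ^ (n + 2)}) + card (S \<inter> {2 ^ (n + 2)..<2 ^ (n + 2 + 3)})" by linarith
    also have "\<dots> = card (S \<inter> {..<2 ^ (n + 2)} \<union> S \<inter> {2 ^ (n + 2)..<2 ^ (n + 2 + 3)})"
      by (rule card_Un_disjoint[symmetric]) auto
    also have "\<dots> \<le> card (S \<inter> {..<2 ^ (Suc (Suc (Suc n)) + 2)})"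
    proof (rule card_mono)
      have "(2::nat) ^ (n + 2) \<le> 2 ^ (n + 2 + 3)" by (rule power_increasing) auto
      then show "S \<inter> {..<2 ^ (n + 2)} \<union> S \<inter> {2 ^ (n + 2)..<2 ^ (n + 2 + 3)}
          \<subseteq> S \<inter> {..<2 ^ (Suc (Suc (Suc n)) + 2)}"
        by (auto simp: power_add)
    qed simp
    finally show ?case by simp
  }
qed

text \<open>For \<open>n = 0\<close> the single vertex needs a dominator outside of \<open>ST_verts 0\<close>.\<close>

lemma ex_dominating_set_card_le_td_count:
  "\<exists>S. S \<subseteq> {1..<2 ^ (max 1 n + 1)} \<and> card S \<le> td_count n \<and>
    (\<forall>v\<in>{1..<2 ^ (n + 1)}. \<exists>u\<in>S. sibling_tree_adj v u)"
proof (induction n rule: td_count.induct)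
  case 1
  show ?case by (rule exI[of _ "{2}"]) (auto simp: sibling_tree_adj_def)
next
  \<comment> \<open>2 and 3 dominate each other, the root and all of level 2, which settles the
    heights 1 and 2.\<close>
  case 2
  show ?case by (rule exI[of _ "{2, 3}"]) (auto simp: sibling_tree_adj_def)
next
  case 3
  show ?case by (rule exI[of _ "{2, 3}"]) (auto simp: sibling_tree_adj_def)
next
  case (4 n)
  then obtain S where S: "S \<subseteq> {1..<2 ^ (max 1 n + 1)}" "card S \<le> td_count n"
    and dom: "\<And>v. 1 \<le> v \<Longrightarrow> v < 2 ^ (n + 1) \<Longrightarrow> \<exists>u\<in>S. sibling_tree_adj v u" by auto
  \<comment> \<open>\<open>N\<close> is the first vertex of level \<open>n + 1\<close>, so
    \<open>{2 * N..<4 * N}\<close> is level \<open>n + 2\<close>. The vertices from \<open>N\<close>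
    on are dominated by a child, a sibling or the parent there.\<close>
  define N :: nat where "N = 2 ^ (n + 1)"
  have N: "2 ^ (n + 2) = 2 * N" "2 ^ (n + 3) = 4 * N" "2 ^ (n + 4) = 8 * N" "0 < N" "even N"
    by (simp_all add: N_def power_add)
  let ?T = "S \<union> {2 * N..<4 * N}"
  have "(2::nat) ^ (max 1 n + 1) \<le> 2 ^ (n + 4)" by (rule power_increasing) auto
  then have sub: "?T \<subseteq> {1..<8 * N}" using S(1) N by auto
  have "card ?T \<le> card S + card {2 * N..<4 * N}" by (rule card_Un_le)
  then have card: "card ?T \<le> td_count n + 2 * N" using S(2) by simp
  have "\<exists>u\<in>?T. sibling_tree_adj v u" if "1 \<le> v" "v < 8 * N" for v
  proof -
    consider "v < N" | "N \<le> v" "v < 2 * N" | "2 * N \<le> v" "v < 4 * N" | "4 * N \<le> v"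
      by linarith
    then show ?thesis
    proof cases
      case 1
      then show ?thesis using dom that unfolding N_def by blast
    next
      case 2
      then show ?thesis by (intro bexI[of _ "2 * v"]) (auto simp: sibling_tree_adj_def)
    next
      case 3
      show ?thesis
      proof (cases "even v")
        case True
        \<comment> \<open>Both ends of the interval are even, so no sibling pair is split.\<close>
        then have "v + 1 < 4 * N" using 3 by presburger
        with 3 True show ?thesis by (intro bexI[of _ "v + 1"]) (auto simp: sibling_tree_adj_def)
      next
        case False
        then have "2 * N \<le> v - 1" "(v - 1) div 2 = v div 2" "v - 1 \<noteq> v"
          using 3 by presburger+
        with 3 show ?thesis by (intro bexI[of _ "v - 1"]) (auto simp: sibling_tree_adj_def)
      qed
    next
      case 4
      then show ?thesis using that by (intro bexI[of _ "v div 2"]) (auto simp: sibling_tree_adj_def)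
    qed
  qed
  moreover have "max 1 (Suc (Suc (Suc n))) + 1 = n + 4" "Suc (Suc (Suc n)) + 1 = n + 4"
    by auto
  ultimately show ?case using sub card N by (intro exI[of _ ?T]) (simp only: td_count.simps, auto)
qed

lemma total_domination_number_ST:
  assumes "n \<ge> 1"
  shows "total_domination_number (ST_verts n) (ST_edges n) = td_count n"
proof -
  let ?F = "{S. total_dominating_set (ST_verts n) (ST_edges n) S}"
  have "?F \<subseteq> Pow (ST_verts n)" by (auto simp: total_dominating_set_def)
  then have fin: "finite ?F" by (rule finite_subset) (simp add: ST_verts_def)
  have lower: "td_count n \<le> card S" if "S \<in> ?F" for S
  proof -
    from that have S: "S \<subseteq> ST_verts n" "\<And>v. v \<in> ST_verts n \<Longrightarrow> \<exists>u\<in>S. sibling_tree_adj v u"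
      by (auto simp: total_dominating_set_def adjacent_ST_iff)
    \<comment> \<open>\<open>S\<close> has no vertex on level \<open>n + 1\<close>, so allowing that
      level costs nothing.\<close>
    then have "td_count n \<le> card (S \<inter> {..<2 ^ (n + 2)})"
      by (intro td_count_le_card) (auto simp: mem_ST_verts)
    also have "\<dots> \<le> card S"
      using S(1) by (intro card_mono) (auto intro: finite_subset simp: ST_verts_def)
    finally show ?thesis .
  qed
  have verts: "ST_verts n = {1..<2 ^ (n + 1)}" by (auto simp: mem_ST_verts)
  \<comment> \<open>As \<open>n \<ge> 1\<close>, \<open>max 1 n\<close> is \<open>n\<close> and the
    witness stays inside the tree.\<close>
  obtain S where "S \<subseteq> ST_verts n" and card: "card S \<le> td_count n"
    and "\<forall>v\<in>ST_verts n. \<exists>u\<in>S. sibling_tree_adj v u"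
    using ex_dominating_set_card_le_td_count[of n] assms by (auto simp: verts max_def)
  then have S: "S \<in> ?F"
    unfolding total_dominating_set_def adjacent_ST_iff by blast
  then have "td_count n \<in> card ` ?F" using lower[OF S] card by (metis imageI le_antisym)
  then show ?thesis
    unfolding total_domination_number_def using fin lower by (intro Min_eqI) auto
qed

theorem theorem6:
  fixes n :: nat
  assumes "n \<ge> 1"
  shows "real (total_domination_number (ST_verts n) (ST_edges n)) =
    (if n mod 3 = 0 then 1 / 7 * (2 ^ (n + 2) + 3)
     else if n mod 3 = 1 then 1 / 7 * (2 ^ (n + 2) - 1) + 1
     else 2 / 7 * (2 ^ (n + 1) - 1))"
  unfolding total_domination_number_ST[OF assms] by (rule td_count_closed_form)

end
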